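(* Let $F$ be the error profile of a list of $n\ge2$ states in a finite-dimensional GPT state space, and let $A,B\subseteq[n]$ satisfy $A\cap B=\{j\}$ for some $j\in[n]$. Then $$F(A\cup B)\ge F(A)+F(B).$$
   Context: $[n]=\{1,\ldots,n\}$. A finite-dimensional GPT state space is a nonempty compact convex subset $K$ of some $\mathbb R^d$, $d\ge1$. A (finite-outcome) measurement on $K$ is a finite family $(e_x)_{x\in X}$ of nonnegative affine functions on $K$ with $\sum_{x}e_x=1$; every such family is allowed. For a list of (not necessarily distinct) states $s_1,\ldots,s_n\in K$ and nonempty $H\subseteq[n]$, $D(H)=\max\sum_{i\in H}e_i(s_i)$, the maximum over all measurements $(e_i)_{i\in H}$ indexed by $H$, and $F(H)=|H|-D(H)$; also $D(\varnothing)=F(\varnothing)=0$. $F$ is the error profile of the list. *)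

theory Defs
  imports "HOL-Analysis.Analysis"
begin

definition gpt_state_space :: "'a::euclidean_space set \<Rightarrow> bool" where
  "gpt_state_space K \<longleftrightarrow> K \<noteq> {} \<and> compact K \<and> convex K"

text \<open>Functions are total on the ambient space, but only their values on the convex set \<open>K\<close> matter:
  \<open>f\<close> is affine on \<open>K\<close> if it preserves the convex combinations of points of \<open>K\<close>.\<close>

definition affine_fun_on :: "'a::real_vector set \<Rightarrow> ('a \<Rightarrow> real) \<Rightarrow> bool" where
  "affine_fun_on K f \<longleftrightarrow>
     (\<forall>x\<in>K. \<forall>y\<in>K. \<forall>t\<in>{0..1}. f ((1 - t) *\<^sub>R x + t *\<^sub>R y) = (1 - t) * f x + t * f y)"

definition measurement :: "'a::euclidean_space set \<Rightarrow> 'x set \<Rightarrow> ('x \<Rightarrow> 'a \<Rightarrow> real) \<Rightarrow> bool" where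
  "measurement K X e \<longleftrightarrow>
     finite X \<and>
     (\<forall>x\<in>X. affine_fun_on K (e x) \<and> (\<forall>p\<in>K. 0 \<le> e x p)) \<and>
     (\<forall>p\<in>K. (\<Sum>x\<in>X. e x p) = 1)"

text \<open>A list of states \<open>s\<^sub>1, \<dots>, s\<^sub>n\<close> is represented by a function on \<open>nat\<close>, only the values at
  the indices in \<open>{1..n}\<close> being relevant. The supremum below is a maximum, see
  \<open>discrimination_value_attained\<close>.\<close>

definition discrimination_value :: "'a::euclidean_space set \<Rightarrow> (nat \<Rightarrow> 'a) \<Rightarrow> nat set \<Rightarrow> real" where
  "discrimination_value K s H =
     (if H = {} then 0 else Sup {\<Sum>i\<in>H. e i (s i) | e. measurement K H e})"

definition error_profile :: "'a::euclidean_space set \<Rightarrow> (nat \<Rightarrow> 'a) \<Rightarrow> nat set \<Rightarrow> real" where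
  "error_profile K s H = real (card H) - discrimination_value K s H"

lemma discrimination_value_attained:
  fixes K :: "'a::euclidean_space set" and s :: "nat \<Rightarrow> 'a"
  assumes K: "gpt_state_space K" and H: "finite H" "H \<noteq> {}" and s: "\<And>i. i \<in> H \<Longrightarrow> s i \<in> K"
  shows "\<exists>e. measurement K H e \<and> discrimination_value K s H = (\<Sum>i\<in>H. e i (s i))
           \<and> (\<forall>e'. measurement K H e' \<longrightarrow> (\<Sum>i\<in>H. e' i (s i)) \<le> (\<Sum>i\<in>H. e i (s i)))"
proof -
  let ?v = "\<lambda>e. \<Sum>i\<in>H. e i (s i)"
  define B where "B = (Pi\<^sub>E UNIV (\<lambda>_. {0..1}) :: (nat \<times> 'a \<Rightarrow> real) set)"
  define C where "C = {g :: nat \<times> 'a \<Rightarrow> real. measurement K H (curry g)}"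
  have cont: "continuous_on UNIV (\<lambda>g. g z)" for z :: "nat \<times> 'a"
    by (rule continuous_on_product_coordinates)
  have "compact B"
  proof -
    have "compactin (product_topology (\<lambda>_. euclidean) UNIV) B"
      unfolding B_def by (subst compactin_PiE) simp
    then show ?thesis by (simp add: euclidean_product_topology)
  qed
  moreover have "closed C"
    unfolding C_def measurement_def affine_fun_on_def curry_def Ball_def
    by (intro closed_Collect_conj closed_Collect_all closed_Collect_imp closed_Collect_eq
          closed_Collect_le continuous_intros cont open_Collect_const closed_Collect_const)
  ultimately have comp: "compact (B \<inter> C)" by (rule compact_Int_closed)
  have into: "\<exists>g\<in>B \<inter> C. ?v (curry g) = ?v e" if e: "measurement K H e" for e
  proof -
    define g where "g = (\<lambda>(i, p). if i \<in> H \<and> p \<in> K then e i p else 0)"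
    have conv: "(1 - t) *\<^sub>R x + t *\<^sub>R y \<in> K" if "x \<in> K" "y \<in> K" "t \<in> {0..1}" for x y t
      using K that unfolding gpt_state_space_def convex_alt by auto
    have le1: "e i p \<le> 1" if "i \<in> H" "p \<in> K" for i p
    proof -
      have "e i p \<le> (\<Sum>i\<in>H. e i p)"
        using e that unfolding measurement_def by (intro member_le_sum) auto
      then show ?thesis using e that unfolding measurement_def by simp
    qed
    have "g \<in> B"
      using e le1 unfolding B_def g_def measurement_def by auto
    moreover have "g \<in> C"
      using e conv unfolding C_def g_def measurement_def affine_fun_on_def by simp
    moreover have "?v (curry g) = ?v e"
      using s unfolding g_def by (intro sum.cong) auto
    ultimately show ?thesis by blast
  qed
  have "measurement K H (\<lambda>_ _. 1 / real (card H))"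
    using H unfolding measurement_def affine_fun_on_def by (auto simp: field_simps)
  then have ne: "B \<inter> C \<noteq> {}" using into by blast
  have "continuous_on (B \<inter> C) (\<lambda>g. ?v (curry g))"
    unfolding curry_def by (intro continuous_on_sum continuous_on_subset[OF cont]) auto
  then obtain g where g: "g \<in> B \<inter> C" "\<And>g'. g' \<in> B \<inter> C \<Longrightarrow> ?v (curry g') \<le> ?v (curry g)"
    using continuous_attains_sup[OF comp ne] by blast
  have max: "?v e \<le> ?v (curry g)" if "measurement K H e" for e
    using into[OF that] g(2) by metis
  have meas: "measurement K H (curry g)" using g(1) by (simp add: C_def)
  have "Sup {?v e | e. measurement K H e} = ?v (curry g)"
    by (rule cSup_eq_maximum) (use meas max in blast)+
  then show ?thesis
    using H meas max by (auto simp: discrimination_value_def)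
qed

end

(* Take an optimal measurement e on the union and coarse-grain it to A (and likewise to B) by
   assigning every outcome outside A to j, so that the outcome j becomes 1 - sum of e i over
   A - {j}. As A - {j} and B - {j} partition the complement of j in the union and the e i sum
   to 1 at s j, the two values add up to D(A Un B) + 1. *)
theory Submission
  imports Defs
begin

lemma affine_fun_on_one_minus_sum:
  assumes "\<And>i. i \<in> I \<Longrightarrow> affine_fun_on K (f i)"
  shows "affine_fun_on K (\<lambda>p. 1 - (\<Sum>i\<in>I. f i p))"
proof -
  have "(\<Sum>i\<in>I. f i ((1 - t) *\<^sub>R x + t *\<^sub>R y)) = (1 - t) * (\<Sum>i\<in>I. f i x) + t * (\<Sum>i\<in>I. f i y)"
    if "x \<in> K" "y \<in> K" "t \<in> {0..1}" for x y t
    using assms that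
    by (simp add: affine_fun_on_def sum.distrib sum_distrib_left)
  then show ?thesis
    unfolding affine_fun_on_def by (simp add: algebra_simps)
qed

text \<open>On \<open>K\<close> the new outcome \<open>j\<close> equals \<open>e j\<close> plus all
  \<open>e i\<close> with \<open>i\<close> in \<open>H - A\<close>. Writing it as a complement makes
  the outcomes sum to 1 at once and leaves only nonnegativity, which holds since a partial sum of
  the nonnegative \<open>e i\<close> is at most the total 1.\<close>

lemma measurement_coarse_grain:
  assumes e: "measurement K H e" and "A \<subseteq> H" "j \<in> A"
  shows "measurement K A (e(j := \<lambda>p. 1 - (\<Sum>i\<in>A - {j}. e i p)))"
proof -
  have fin: "finite H" "finite A"
    using e \<open>A \<subseteq> H\<close> finite_subset by (auto simp: measurement_def)
  have "(\<Sum>i\<in>A - {j}. e i p) \<le> 1" if "p \<in> K" for p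
  proof -
    have "(\<Sum>i\<in>A - {j}. e i p) \<le> (\<Sum>i\<in>H. e i p)"
      using e fin \<open>A \<subseteq> H\<close> that by (intro sum_mono2) (auto simp: measurement_def)
    then show ?thesis
      using e that by (simp add: measurement_def)
  qed
  moreover have "affine_fun_on K (\<lambda>p. 1 - (\<Sum>i\<in>A - {j}. e i p))"
    using e \<open>A \<subseteq> H\<close> by (intro affine_fun_on_one_minus_sum) (auto simp: measurement_def)
  ultimately show ?thesis
    using e fin \<open>A \<subseteq> H\<close> \<open>j \<in> A\<close> by (auto simp: measurement_def sum.remove[of A j])
qed

text \<open>The coarse-grained measurement competes in the maximum for \<open>A\<close>. Its value
  is split at \<open>j\<close>, so that what depends on \<open>s j\<close> stands apart and can be
  combined for two sets that share \<open>j\<close>.\<close>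

lemma discrimination_value_ge_coarse_grain:
  assumes "gpt_state_space K" and e: "measurement K H e" and "A \<subseteq> H" "j \<in> A"
    and "\<And>i. i \<in> A \<Longrightarrow> s i \<in> K"
  shows "discrimination_value K s A
           \<ge> (\<Sum>i\<in>A - {j}. e i (s i)) + (1 - (\<Sum>i\<in>A - {j}. e i (s j)))"
proof -
  let ?e = "e(j := \<lambda>p. 1 - (\<Sum>i\<in>A - {j}. e i p))"
  have fin: "finite A"
    using e \<open>A \<subseteq> H\<close> finite_subset by (auto simp: measurement_def)
  have "(\<Sum>i\<in>A. ?e i (s i)) \<le> discrimination_value K s A"
    using discrimination_value_attained[of K A s] measurement_coarse_grain[OF e \<open>A \<subseteq> H\<close> \<open>j \<in> A\<close>]
      assms fin by fastforce
  then show ?thesis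
    using fin \<open>j \<in> A\<close> by (simp add: sum.remove[of A j])
qed

theorem proposition2p3:
  fixes K :: "'a::euclidean_space set" and s :: "nat \<Rightarrow> 'a" and n j :: nat and A B :: "nat set"
  assumes "gpt_state_space K"
    and "n \<ge> 2"
    and "\<And>i. i \<in> {1..n} \<Longrightarrow> s i \<in> K"
    and "A \<subseteq> {1..n}" and "B \<subseteq> {1..n}"
    and "j \<in> {1..n}" and "A \<inter> B = {j}"
  shows "error_profile K s (A \<union> B) \<ge> error_profile K s A + error_profile K s B"
proof -
  let ?D = "discrimination_value K s"
  have fin: "finite A" "finite B"
    using \<open>A \<subseteq> {1..n}\<close> \<open>B \<subseteq> {1..n}\<close> by (simp_all add: finite_subset)
  have j: "j \<in> A" "j \<in> B" and sj: "s j \<in> K"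
    using \<open>A \<inter> B = {j}\<close> assms(3)[OF \<open>j \<in> {1..n}\<close>] by auto
  have sAB: "s i \<in> K" if "i \<in> A \<union> B" for i
    using assms(3-5) that by blast
  obtain e where e: "measurement K (A \<union> B) e" and val: "?D (A \<union> B) = (\<Sum>i\<in>A \<union> B. e i (s i))"
    using discrimination_value_attained[of K "A \<union> B" s] assms(1) sAB fin j by blast
  \<comment> \<open>Stated for arbitrary \<open>f\<close> because it serves twice: for the optimal
    value, with terms \<open>e i (s i)\<close>, and for the normalization at \<open>s j\<close>,
    with terms \<open>e i (s j)\<close>.\<close>
  have split: "sum f (A \<union> B) = f j + sum f (A - {j}) + sum f (B - {j})" for f :: "nat \<Rightarrow> real"
  proof -
    have "A \<union> B = insert j ((A - {j}) \<union> (B - {j}))" "(A - {j}) \<inter> (B - {j}) = {}"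
      using \<open>A \<inter> B = {j}\<close> by auto
    then show ?thesis
      using fin by (simp add: sum.union_disjoint)
  qed
  \<comment> \<open>The two bounds below subtract the \<open>e i (s j)\<close> with
    \<open>i \<noteq> j\<close>, together \<open>1 - e j (s j)\<close>, from 2. What remains is 1
    plus the term \<open>e j (s j)\<close> that completes the optimal value.\<close>
  have "(\<Sum>i\<in>A \<union> B. e i (s j)) = 1"
    using e sj by (simp add: measurement_def)
  moreover have "?D A \<ge> (\<Sum>i\<in>A - {j}. e i (s i)) + (1 - (\<Sum>i\<in>A - {j}. e i (s j)))"
    by (rule discrimination_value_ge_coarse_grain[OF _ e]) (use assms(1) sAB j in auto)
  moreover have "?D B \<ge> (\<Sum>i\<in>B - {j}. e i (s i)) + (1 - (\<Sum>i\<in>B - {j}. e i (s j)))"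
    by (rule discrimination_value_ge_coarse_grain[OF _ e]) (use assms(1) sAB j in auto)
  ultimately have "?D A + ?D B \<ge> ?D (A \<union> B) + 1"
    by (simp add: val split)
  \<comment> \<open>The shared index \<open>j\<close> is counted twice, and this surplus 1 cancels
    the 1 gained in the discrimination values.\<close>
  moreover have "card A + card B = card (A \<union> B) + 1"
    using card_Un_Int[OF fin] \<open>A \<inter> B = {j}\<close> by simp
  ultimately show ?thesis
    unfolding error_profile_def by linarith
qed

end
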